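(* Let $3\le p\le n$ and let $\alpha,\beta\in\mathcal{OCT}_n$ be such that $$\alpha=\begin{pmatrix} A_1 & A_2 & \cdots & A_{p-1} & A_p\\ x+1 & x+2 & \cdots & x+p-1 & x+p\end{pmatrix},$$ i.e. $\alpha$ has image $\{x+1,\ldots,x+p\}$ and kernel classes $A_1<\cdots<A_p$ with $A_i\alpha=\{x+i\}$ for $1\le i\le p$. Then $\alpha\le\beta$ if and only if (i) $\operatorname{im}\alpha\subseteq\operatorname{im}\beta$; (ii) $(x+i)\beta^{-1}=A_i$ for all $i\in\{2,3,\ldots,p-1\}$; and (iii) $(\max A_1)\beta=x+1$ and $(\min A_p)\beta=x+p$.
   Context: $[n]=\{1,2,\ldots,n\}$ with its usual order. Maps are written on the right of their arguments. $\mathcal{OCT}_n$ is the semigroup (under composition, $x(\alpha\beta)=(x\alpha)\beta$) of all maps $\alpha:[n]\to[n]$ that are contractions ($|x\alpha-y\alpha|\le|x-y|$ for all $x,y\in[n]$) and order-preserving ($x\le y\Rightarrow x\alpha\le y\alpha$). The kernel classes of $\alpha$ are the equivalence classes of $\{(u,v): u\alpha=v\alpha\}$; $A<B$ means every element of $A$ is less than every element of $B$. $\operatorname{im}$ denotes image; $y\beta^{-1}=\{u\in[n]:u\beta=y\}$ is the preimage of $y$; $x\ge0$ is an integer. The natural partial order on a semigroup $S$: $\alpha\le\beta$ iff there exist $\lambda,\mu\in S^1$ with $\alpha=\lambda\beta=\beta\mu$ and $\alpha=\alpha\mu$; here $S=\mathcal{OCT}_n$. *)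

theory Defs
  imports Main "HOL-Library.FuncSet"
begin

text \<open>
  For a semigroup with carrier \<open>S\<close> and operation \<open>f\<close>, the monoid \<open>S\<^sup>1\<close> is \<open>S\<close> itself if it
  already has an identity, and \<open>S\<close> with a new identity adjoined otherwise. It is encoded in
  the option type: \<open>Some a\<close> is the element \<open>a\<close> of \<open>S\<close>, and \<open>None\<close> is the adjoined identity.
\<close>

definition has_identity :: "'a set \<Rightarrow> ('a \<Rightarrow> 'a \<Rightarrow> 'a) \<Rightarrow> bool" where
  "has_identity S f \<longleftrightarrow> (\<exists>e\<in>S. \<forall>a\<in>S. f e a = a \<and> f a e = a)"

definition carrier1 :: "'a set \<Rightarrow> ('a \<Rightarrow> 'a \<Rightarrow> 'a) \<Rightarrow> 'a option set" where
  "carrier1 S f = (if has_identity S f then Some ` S else insert None (Some ` S))"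

fun mult1 :: "('a \<Rightarrow> 'a \<Rightarrow> 'a) \<Rightarrow> 'a option \<Rightarrow> 'a option \<Rightarrow> 'a option" where
  "mult1 f None b = b"
| "mult1 f a None = a"
| "mult1 f (Some a) (Some b) = Some (f a b)"

definition natural_le :: "'a set \<Rightarrow> ('a \<Rightarrow> 'a \<Rightarrow> 'a) \<Rightarrow> 'a \<Rightarrow> 'a \<Rightarrow> bool" where
  "natural_le S f a b \<longleftrightarrow>
     (\<exists>l\<in>carrier1 S f. \<exists>m\<in>carrier1 S f.
        Some a = mult1 f l (Some b) \<and>
        Some a = mult1 f (Some b) m \<and>
        Some a = mult1 f (Some a) m)"

text \<open>
  A self-map of \<open>{1..n}\<close> is an extensional function, so that equality of functions is equality
  of maps. Distances are taken in \<open>int\<close>, since subtraction on \<open>nat\<close> truncates.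
\<close>

definition OCT :: "nat \<Rightarrow> (nat \<Rightarrow> nat) set" where
  "OCT n = {\<alpha> \<in> {1..n} \<rightarrow>\<^sub>E {1..n}.
     (\<forall>x\<in>{1..n}. \<forall>y\<in>{1..n}. \<bar>int (\<alpha> x) - int (\<alpha> y)\<bar> \<le> \<bar>int x - int y\<bar>) \<and>
     (\<forall>x\<in>{1..n}. \<forall>y\<in>{1..n}. x \<le> y \<longrightarrow> \<alpha> x \<le> \<alpha> y)}"

text \<open>Maps act on the right: in the product \<open>\<alpha>\<beta>\<close> the map \<open>\<alpha>\<close> is applied first.\<close>

definition rcomp :: "nat \<Rightarrow> (nat \<Rightarrow> nat) \<Rightarrow> (nat \<Rightarrow> nat) \<Rightarrow> (nat \<Rightarrow> nat)" where
  "rcomp n \<alpha> \<beta> = compose {1..n} \<beta> \<alpha>"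

definition ker :: "nat \<Rightarrow> (nat \<Rightarrow> nat) \<Rightarrow> (nat \<times> nat) set" where
  "ker n \<alpha> = {(u, v). u \<in> {1..n} \<and> v \<in> {1..n} \<and> \<alpha> u = \<alpha> v}"

definition set_less :: "nat set \<Rightarrow> nat set \<Rightarrow> bool" where
  "set_less A B \<longleftrightarrow> (\<forall>a\<in>A. \<forall>b\<in>B. a < b)"

lemma rcomp_in_OCT:
  assumes "\<alpha> \<in> OCT n" "\<beta> \<in> OCT n"
  shows "rcomp n \<alpha> \<beta> \<in> OCT n"
proof -
  have mem: "\<alpha> u \<in> {1..n}" "\<beta> u \<in> {1..n}" if "u \<in> {1..n}" for u
    using assms that unfolding OCT_def by (blast dest: PiE_mem)+
  have ext: "rcomp n \<alpha> \<beta> \<in> {1..n} \<rightarrow>\<^sub>E {1..n}"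
    using mem by (auto simp: rcomp_def compose_def)
  have eq: "rcomp n \<alpha> \<beta> u = \<beta> (\<alpha> u)" if "u \<in> {1..n}" for u
    using that by (simp add: rcomp_def compose_def)
  have "\<bar>int (\<beta> (\<alpha> u)) - int (\<beta> (\<alpha> v))\<bar> \<le> \<bar>int u - int v\<bar>"
    if "u \<in> {1..n}" "v \<in> {1..n}" for u v
  proof -
    have "\<bar>int (\<beta> (\<alpha> u)) - int (\<beta> (\<alpha> v))\<bar> \<le> \<bar>int (\<alpha> u) - int (\<alpha> v)\<bar>"
      using assms(2) mem(1)[OF that(1)] mem(1)[OF that(2)] unfolding OCT_def by blast
    also have "\<dots> \<le> \<bar>int u - int v\<bar>"
      using assms(1) that unfolding OCT_def by blast
    finally show ?thesis .
  qed
  moreover have "\<beta> (\<alpha> u) \<le> \<beta> (\<alpha> v)"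
    if "u \<in> {1..n}" "v \<in> {1..n}" "u \<le> v" for u v
  proof -
    have "\<alpha> u \<le> \<alpha> v"
      using assms(1) that unfolding OCT_def by blast
    then show ?thesis
      using assms(2) mem(1)[OF that(1)] mem(1)[OF that(2)] unfolding OCT_def by blast
  qed
  ultimately show ?thesis
    using ext unfolding OCT_def by (simp add: eq)
qed

lemma rcomp_assoc:
  assumes "\<alpha> \<in> OCT n"
  shows "rcomp n (rcomp n \<alpha> \<beta>) \<gamma> = rcomp n \<alpha> (rcomp n \<beta> \<gamma>)"
proof -
  have "\<alpha> u \<in> {1..n}" if "u \<in> {1..n}" for u
    using assms that unfolding OCT_def by (blast dest: PiE_mem)
  then show ?thesis
    by (auto simp: rcomp_def compose_def restrict_def fun_eq_iff)
qed

end

theory Submission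
  imports Defs
begin

text \<open>
  The monoid of order-preserving contractions has an identity, so \<open>\<alpha> \<le> \<beta>\<close> asks for genuine
  elements with \<open>\<alpha> = \<lambda>\<beta> = \<beta>\<mu>\<close> and \<open>\<alpha> = \<alpha>\<mu>\<close>; the last equation says that \<open>\<mu>\<close> fixes
  \<open>im \<alpha> = {x+1..x+p}\<close> pointwise.

  Suppose such elements exist. Condition (i) is read off from \<open>\<alpha> = \<lambda>\<beta>\<close>. A monotone map that
  fixes both neighbours of \<open>y\<close> sends no point other than \<open>y\<close> itself to \<open>y\<close>. Hence applying \<open>\<mu>\<close>
  after \<open>\<beta>\<close> leaves the fibres of \<open>\<beta>\<close> over the interior
  points \<open>x+2, \<dots>, x+p-1\<close> unchanged, which is (ii). For (iii), \<open>max A\<^sub>1 + 1\<close> lies in \<open>A\<^sub>2\<close>, so \<open>\<beta>\<close>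
  sends it to \<open>x+2\<close>; as \<open>\<beta>\<close> is a contraction and \<open>max A\<^sub>1\<close> is outside that fibre, \<open>max A\<^sub>1\<close> has
  to go to \<open>x+1\<close>. The other end is symmetric. Here \<open>p \<ge> 3\<close> guarantees that an interior point
  exists.

  Conversely, truncation to an interval is an order-preserving contraction. Truncating to
  \<open>{x+1..x+p}\<close> after \<open>\<beta>\<close>, or to \<open>{max A\<^sub>1..min A\<^sub>p}\<close> before \<open>\<beta>\<close>, turns \<open>\<beta>\<close> into \<open>\<alpha>\<close>: by (ii) the
  two maps already agree strictly between \<open>max A\<^sub>1\<close> and \<open>min A\<^sub>p\<close>, and outside (iii) together with
  monotonicity puts the values of \<open>\<beta>\<close> at or beyond the end points \<open>x+1\<close> and \<open>x+p\<close>.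
\<close>

lemma OCT_mem: "\<alpha> \<in> OCT n \<Longrightarrow> u \<in> {1..n} \<Longrightarrow> \<alpha> u \<in> {1..n}"
  unfolding OCT_def by (blast dest: PiE_mem)

lemma OCT_mono: "\<alpha> \<in> OCT n \<Longrightarrow> u \<in> {1..n} \<Longrightarrow> v \<in> {1..n} \<Longrightarrow> u \<le> v \<Longrightarrow> \<alpha> u \<le> \<alpha> v"
  unfolding OCT_def by blast

lemma OCT_Suc_le:
  assumes "\<alpha> \<in> OCT n" "u \<in> {1..n}" "Suc u \<in> {1..n}"
  shows "\<alpha> (Suc u) \<le> Suc (\<alpha> u)"
proof -
  have "\<bar>int (\<alpha> (Suc u)) - int (\<alpha> u)\<bar> \<le> \<bar>int (Suc u) - int u\<bar>"
    using assms unfolding OCT_def by blast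
  then show ?thesis by linarith
qed

lemma OCT_eqI:
  assumes "\<alpha> \<in> OCT n" "\<beta> \<in> OCT n" "\<And>u. u \<in> {1..n} \<Longrightarrow> \<alpha> u = \<beta> u"
  shows "\<alpha> = \<beta>"
  using assms unfolding OCT_def by (blast intro: PiE_ext)

lemma rcomp_apply: "u \<in> {1..n} \<Longrightarrow> rcomp n \<alpha> \<beta> u = \<beta> (\<alpha> u)"
  by (simp add: rcomp_def compose_def)

definition truncate_to :: "nat \<Rightarrow> nat \<Rightarrow> nat \<Rightarrow> nat \<Rightarrow> nat" where
  "truncate_to n a b = (\<lambda>u\<in>{1..n}. max a (min b u))"

lemma truncate_to_in_OCT:
  assumes "a \<in> {1..n}" "b \<in> {1..n}"
  shows "truncate_to n a b \<in> OCT n"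
  using assms unfolding OCT_def truncate_to_def by auto

lemma has_identity_OCT: "has_identity (OCT n) (rcomp n)"
proof -
  define e where "e = (\<lambda>u\<in>{1..n}. u)"
  have e: "e \<in> OCT n"
    unfolding OCT_def e_def by auto
  have "rcomp n e \<alpha> = \<alpha> \<and> rcomp n \<alpha> e = \<alpha>" if "\<alpha> \<in> OCT n" for \<alpha>
    using e that OCT_mem[OF that]
    by (auto intro!: OCT_eqI[of _ n] rcomp_in_OCT simp: rcomp_apply e_def)
  with e show ?thesis
    unfolding has_identity_def by blast
qed

lemma rcomp_eq_iff:
  assumes "\<alpha> \<in> OCT n" "\<beta> \<in> OCT n" "\<gamma> \<in> OCT n"
  shows "\<alpha> = rcomp n \<beta> \<gamma> \<longleftrightarrow> (\<forall>u\<in>{1..n}. \<gamma> (\<beta> u) = \<alpha> u)"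
  using assms by (auto intro!: OCT_eqI[of _ n] rcomp_in_OCT simp: rcomp_apply)

lemma natural_le_OCT_iff:
  assumes "\<alpha> \<in> OCT n" "\<beta> \<in> OCT n"
  shows "natural_le (OCT n) (rcomp n) \<alpha> \<beta> \<longleftrightarrow>
    (\<exists>l\<in>OCT n. \<exists>m\<in>OCT n. \<forall>u\<in>{1..n}. \<beta> (l u) = \<alpha> u \<and> m (\<beta> u) = \<alpha> u \<and> m (\<alpha> u) = \<alpha> u)"
proof -
  have "natural_le (OCT n) (rcomp n) \<alpha> \<beta> \<longleftrightarrow>
    (\<exists>l\<in>OCT n. \<exists>m\<in>OCT n. \<alpha> = rcomp n l \<beta> \<and> \<alpha> = rcomp n \<beta> m \<and> \<alpha> = rcomp n \<alpha> m)"
    by (simp add: natural_le_def carrier1_def has_identity_OCT)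
  also have "\<dots> \<longleftrightarrow>
    (\<exists>l\<in>OCT n. \<exists>m\<in>OCT n. \<forall>u\<in>{1..n}. \<beta> (l u) = \<alpha> u \<and> m (\<beta> u) = \<alpha> u \<and> m (\<alpha> u) = \<alpha> u)"
    by (intro bex_cong refl) (use assms rcomp_eq_iff in blast)
  finally show ?thesis .
qed

text \<open>
  Each listed class is a full kernel class, and the value \<open>\<alpha>\<close> takes on it determines which
  fibre it is.
\<close>

lemma kernel_class_eq_fibre:
  assumes "{1..n} // ker n \<alpha> = A ` I" "i \<in> I" "\<alpha> ` A i = {y}"
  shows "A i = {u \<in> {1..n}. \<alpha> u = y}"
proof -
  have "A i \<in> {1..n} // ker n \<alpha>" using assms(1,2) by blast
  then obtain v where v: "v \<in> {1..n}" "A i = ker n \<alpha> `` {v}" by (rule quotientE)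
  have A: "A i = {u \<in> {1..n}. \<alpha> u = \<alpha> v}"
    unfolding v(2) ker_def using v(1) by force
  with v(1) have "\<alpha> v \<in> \<alpha> ` A i" by blast
  with A assms(3) show ?thesis by simp
qed

lemma mono_fixed_neighbours_preimage:
  assumes "m \<in> OCT n" "y \<in> {1..n}" "Suc z \<in> {1..n}" "z \<in> {1..n}" "z - 1 \<in> {1..n}"
    and "m (Suc z) = Suc z" "m (z - 1) = z - 1" "m y = z"
  shows "y = z"
proof (rule ccontr)
  assume "y \<noteq> z"
  then consider "Suc z \<le> y" | "y \<le> z - 1" by linarith
  then show False
  proof cases
    case 1
    have "m (Suc z) \<le> m y" using OCT_mono[OF assms(1,3,2) 1] .
    then show False using assms(6,8) by linarith
  next
    case 2
    have "m y \<le> m (z - 1)" using OCT_mono[OF assms(1,2,5) 2] .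
    then show False using assms(5,7,8) by simp
  qed
qed

text \<open>
  The map \<open>m\<close> fixes the interval \<open>im \<alpha>\<close>, and an interior point of an interval has both of its
  neighbours inside it, so \<open>m\<close> can neither merge another value of \<open>\<beta>\<close> into \<open>z\<close> nor move \<open>z\<close>.
\<close>

lemma interior_fibres_agree:
  assumes "\<beta> \<in> OCT n" "m \<in> OCT n" "\<alpha> ` {1..n} = {c..d}" "z \<in> {c<..<d}" "{c..d} \<subseteq> {1..n}"
    and "\<forall>u\<in>{1..n}. m (\<beta> u) = \<alpha> u \<and> m (\<alpha> u) = \<alpha> u"
  shows "{u \<in> {1..n}. \<beta> u = z} = {u \<in> {1..n}. \<alpha> u = z}"
proof -
  have m_fix: "m y = y" if "y \<in> {c..d}" for y
    using that assms(3,6) by (metis imageE)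
  have "\<beta> u = z \<longleftrightarrow> \<alpha> u = z" if u: "u \<in> {1..n}" for u
  proof
    assume "\<beta> u = z"
    then show "\<alpha> u = z" using m_fix[of z] assms(4,6) u by force
  next
    assume "\<alpha> u = z"
    moreover have "Suc z \<in> {c..d}" "z \<in> {c..d}" "z - 1 \<in> {c..d}" using assms(4) by auto
    ultimately show "\<beta> u = z"
      using mono_fixed_neighbours_preimage[OF assms(2) OCT_mem[OF assms(1) u], of z]
        assms(5,6) m_fix u by blast
  qed
  then show ?thesis by blast
qed

text \<open>
  Let \<open>a\<close> be the last point over the minimum \<open>c\<close> of \<open>im \<alpha>\<close>, and \<open>b\<close> the first point over its
  maximum \<open>d\<close>. Agreement of the fibres strictly between \<open>c\<close> and \<open>d\<close> pins \<open>\<beta>\<close> down at \<open>a\<close> and \<open>b\<close>: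
  the next point inwards has an interior value, \<open>\<beta>\<close> changes by at most one per step, and the
  interior fibres are already occupied.
\<close>

lemma end_values_agree:
  assumes \<alpha>: "\<alpha> \<in> OCT n" and \<beta>: "\<beta> \<in> OCT n" and cd: "Suc c < d"
    and a: "a \<in> {1..n}" "\<alpha> a = c" "\<And>u. u \<in> {1..n} \<Longrightarrow> a < u \<Longrightarrow> c < \<alpha> u"
    and b: "b \<in> {1..n}" "\<alpha> b = d" "\<And>u. u \<in> {1..n} \<Longrightarrow> u < b \<Longrightarrow> \<alpha> u < d"
    and fib: "\<And>u z. u \<in> {1..n} \<Longrightarrow> z \<in> {c<..<d} \<Longrightarrow> \<beta> u = z \<longleftrightarrow> \<alpha> u = z"
  shows "\<beta> a = c" "\<beta> b = d"
proof -
  have ab: "a < b"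
    using OCT_mono[OF \<alpha> b(1) a(1)] a(2) b(2) cd by linarith
  show "\<beta> a = c"
  proof -
    have S: "Suc a \<in> {1..n}" using ab b(1) by simp
    have "\<alpha> (Suc a) = Suc c" using OCT_Suc_le[OF \<alpha> a(1) S] a(2) a(3)[OF S] by simp
    then have "\<beta> (Suc a) = Suc c" using fib[OF S, of "Suc c"] cd by simp
    moreover have "\<beta> a \<le> \<beta> (Suc a)" "\<beta> (Suc a) \<le> Suc (\<beta> a)"
      using OCT_mono[OF \<beta> a(1) S] OCT_Suc_le[OF \<beta> a(1) S] by auto
    moreover have "\<beta> a \<noteq> Suc c" using fib[OF a(1), of "Suc c"] a(2) cd by simp
    ultimately show ?thesis by linarith
  qed
  show "\<beta> b = d"
  proof -
    obtain v where v: "b = Suc v" using ab by (cases b) auto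
    have P: "v \<in> {1..n}" and S: "Suc v \<in> {1..n}" using ab a(1) b(1) v by auto
    have "Suc (\<alpha> v) = d" using OCT_Suc_le[OF \<alpha> P S] b(2) b(3)[OF P] v by simp
    then have "Suc (\<beta> v) = d" using fib[OF P, of "\<alpha> v"] cd by simp
    moreover have "\<beta> v \<le> \<beta> b" "\<beta> b \<le> Suc (\<beta> v)"
      using OCT_mono[OF \<beta> P S] OCT_Suc_le[OF \<beta> P S] v by auto
    moreover have "\<beta> b \<noteq> \<beta> v"
      using fib[OF b(1), of "\<beta> v"] b(2) cd \<open>Suc (\<beta> v) = d\<close> by auto
    ultimately show ?thesis by linarith
  qed
qed

text \<open>
  The witnesses are the two truncations: \<open>\<lambda>\<close> acts on the domain and \<open>\<mu>\<close> on the values.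
\<close>

lemma natural_le_by_truncation:
  assumes \<alpha>: "\<alpha> \<in> OCT n" and \<beta>: "\<beta> \<in> OCT n" and cd: "c < d" and im: "\<alpha> ` {1..n} = {c..d}"
    and a: "a \<in> {1..n}" "\<alpha> a = c" "\<And>u. u \<in> {1..n} \<Longrightarrow> a < u \<Longrightarrow> c < \<alpha> u"
    and b: "b \<in> {1..n}" "\<alpha> b = d" "\<And>u. u \<in> {1..n} \<Longrightarrow> u < b \<Longrightarrow> \<alpha> u < d"
    and fib: "\<And>u z. u \<in> {1..n} \<Longrightarrow> z \<in> {c<..<d} \<Longrightarrow> \<beta> u = z \<longleftrightarrow> \<alpha> u = z"
    and ends: "\<beta> a = c" "\<beta> b = d"
  shows "natural_le (OCT n) (rcomp n) \<alpha> \<beta>"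
proof -
  have ab: "a < b"
    using OCT_mono[OF \<alpha> b(1) a(1)] a(2) b(2) cd by linarith
  have cn: "c \<in> {1..n}" "d \<in> {1..n}"
    using OCT_mem[OF \<alpha> a(1)] OCT_mem[OF \<alpha> b(1)] a(2) b(2) by auto
  have "\<beta> (truncate_to n a b u) = \<alpha> u \<and> truncate_to n c d (\<beta> u) = \<alpha> u
      \<and> truncate_to n c d (\<alpha> u) = \<alpha> u" if u: "u \<in> {1..n}" for u
  proof -
    have \<alpha>u: "\<alpha> u \<in> {1..n}" "\<alpha> u \<in> {c..d}" and \<beta>u: "\<beta> u \<in> {1..n}"
      using OCT_mem[OF \<alpha> u] OCT_mem[OF \<beta> u] im u by auto
    consider "u \<le> a" | "a < u" "u < b" | "b \<le> u" by linarith
    then show ?thesis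
    proof cases
      case 1
      have "\<alpha> u = c" using OCT_mono[OF \<alpha> u a(1) 1] a(2) \<alpha>u(2) by simp
      moreover have "\<beta> u \<le> c" using OCT_mono[OF \<beta> u a(1) 1] ends(1) by simp
      ultimately show ?thesis
        using 1 ab cd u \<alpha>u \<beta>u ends by (auto simp: truncate_to_def max_def min_def)
    next
      case 2
      then have "\<alpha> u \<in> {c<..<d}" using a(3) b(3) u by simp
      then show ?thesis
        using 2 fib[OF u, of "\<alpha> u"] u \<alpha>u by (auto simp: truncate_to_def max_def min_def)
    next
      case 3
      have "\<alpha> u = d" using OCT_mono[OF \<alpha> b(1) u 3] b(2) \<alpha>u(2) by simp
      moreover have "d \<le> \<beta> u" using OCT_mono[OF \<beta> b(1) u 3] ends(2) by simp
      ultimately show ?thesis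
        using 3 ab cd u \<alpha>u \<beta>u ends by (auto simp: truncate_to_def max_def min_def)
    qed
  qed
  then show ?thesis
    using natural_le_OCT_iff[OF \<alpha> \<beta>] truncate_to_in_OCT[OF a(1) b(1)] truncate_to_in_OCT[OF cn]
    by blast
qed

theorem theorem26:
  fixes n p x :: nat and \<alpha> \<beta> :: "nat \<Rightarrow> nat" and A :: "nat \<Rightarrow> nat set"
  assumes "3 \<le> p" and "p \<le> n"
    and "\<alpha> \<in> OCT n" and "\<beta> \<in> OCT n"
    and "\<alpha> ` {1..n} = {x + 1..x + p}"
    and "{1..n} // ker n \<alpha> = A ` {1..p}"
    and "\<forall>i\<in>{1..p}. \<forall>j\<in>{1..p}. i < j \<longrightarrow> set_less (A i) (A j)"
    and "\<forall>i\<in>{1..p}. \<alpha> ` A i = {x + i}"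
  shows "natural_le (OCT n) (rcomp n) \<alpha> \<beta> \<longleftrightarrow>
    \<alpha> ` {1..n} \<subseteq> \<beta> ` {1..n} \<and>
    (\<forall>i\<in>{2..p - 1}. {u \<in> {1..n}. \<beta> u = x + i} = A i) \<and>
    \<beta> (Max (A 1)) = x + 1 \<and> \<beta> (Min (A p)) = x + p"
proof -
  note \<alpha> = assms(3) and \<beta> = assms(4) and im = assms(5)
  define a b where "a = Max (A 1)" and "b = Min (A p)"
  have A: "A i = {u \<in> {1..n}. \<alpha> u = x + i}" if "i \<in> {1..p}" for i
    using kernel_class_eq_fibre[OF assms(6) that] assms(8) that by blast
  have A1: "A 1 = {u \<in> {1..n}. \<alpha> u = x + 1}" and Ap: "A p = {u \<in> {1..n}. \<alpha> u = x + p}"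
    using A assms(1) by auto
  have fin: "finite (A 1)" "finite (A p)" unfolding A1 Ap by simp_all
  have "A 1 \<noteq> {}" "A p \<noteq> {}"
    using assms(1,8) by force+
  then have "a \<in> A 1" "b \<in> A p"
    using fin by (simp_all add: a_def b_def)
  then have a: "a \<in> {1..n}" "\<alpha> a = x + 1" and b: "b \<in> {1..n}" "\<alpha> b = x + p"
    unfolding A1 Ap by auto
  have val: "\<alpha> u \<in> {x + 1..x + p}" if "u \<in> {1..n}" for u
    using that im by blast
  have a_last: "x + 1 < \<alpha> u" if "u \<in> {1..n}" "a < u" for u
  proof -
    have "u \<notin> A 1" using Max_ge[OF fin(1), of u] that(2) by (auto simp: a_def)
    then show ?thesis using val[OF that(1)] that(1) unfolding A1 by simp
  qed
  have b_first: "\<alpha> u < x + p" if "u \<in> {1..n}" "u < b" for u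
  proof -
    have "u \<notin> A p" using Min_le[OF fin(2), of u] that(2) by (auto simp: b_def)
    then show ?thesis using val[OF that(1)] that(1) unfolding Ap by simp
  qed
  have len: "Suc (x + 1) < x + p" using assms(1) by simp
  show ?thesis
  proof
    assume "natural_le (OCT n) (rcomp n) \<alpha> \<beta>"
    then obtain l m where l: "l \<in> OCT n" and m: "m \<in> OCT n"
      and eqs: "\<forall>u\<in>{1..n}. \<beta> (l u) = \<alpha> u \<and> m (\<beta> u) = \<alpha> u \<and> m (\<alpha> u) = \<alpha> u"
      unfolding natural_le_OCT_iff[OF \<alpha> \<beta>] by blast
    have sub: "\<alpha> ` {1..n} \<subseteq> \<beta> ` {1..n}"
      using eqs OCT_mem[OF l] by (intro image_subsetI) (rule image_eqI[where x = "l _"], auto)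
    have range: "{x + 1..x + p} \<subseteq> {1..n}"
      unfolding im[symmetric] using OCT_mem[OF \<alpha>] by (rule image_subsetI)
    have fib: "{u \<in> {1..n}. \<beta> u = z} = {u \<in> {1..n}. \<alpha> u = z}"
      if "z \<in> {x + 1<..<x + p}" for z
      by (rule interior_fibres_agree[OF \<beta> m im that range]) (use eqs in blast)
    have fib': "\<beta> u = z \<longleftrightarrow> \<alpha> u = z" if "u \<in> {1..n}" "z \<in> {x + 1<..<x + p}" for u z
      using fib[OF that(2)] that(1) by blast
    have "\<beta> a = x + 1" "\<beta> b = x + p"
      by (rule end_values_agree[OF \<alpha> \<beta> len a a_last b b_first fib']; assumption)+
    moreover have "{u \<in> {1..n}. \<beta> u = x + i} = A i" if "i \<in> {2..p - 1}" for i
    proof -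
      have "x + i \<in> {x + 1<..<x + p}" "i \<in> {1..p}" using that by auto
      then show ?thesis using fib A by metis
    qed
    ultimately show "\<alpha> ` {1..n} \<subseteq> \<beta> ` {1..n} \<and>
        (\<forall>i\<in>{2..p - 1}. {u \<in> {1..n}. \<beta> u = x + i} = A i) \<and>
        \<beta> (Max (A 1)) = x + 1 \<and> \<beta> (Min (A p)) = x + p"
      using sub unfolding a_def b_def by blast
  next
    assume R: "\<alpha> ` {1..n} \<subseteq> \<beta> ` {1..n} \<and>
        (\<forall>i\<in>{2..p - 1}. {u \<in> {1..n}. \<beta> u = x + i} = A i) \<and>
        \<beta> (Max (A 1)) = x + 1 \<and> \<beta> (Min (A p)) = x + p"
    have fib: "\<beta> u = z \<longleftrightarrow> \<alpha> u = z" if u: "u \<in> {1..n}" and z: "z \<in> {x + 1<..<x + p}" for u z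
    proof -
      define i where "i = z - x"
      have i: "i \<in> {2..p - 1}" "i \<in> {1..p}" "z = x + i" using z by (auto simp: i_def)
      then have "{u \<in> {1..n}. \<beta> u = z} = {u \<in> {1..n}. \<alpha> u = z}" using R A[OF i(2)] by simp
      then show ?thesis using u by blast
    qed
    show "natural_le (OCT n) (rcomp n) \<alpha> \<beta>"
    proof (rule natural_le_by_truncation[OF \<alpha> \<beta> _ im a a_last b b_first fib])
      show "x + 1 < x + p" using len by simp
      show "\<beta> a = x + 1" "\<beta> b = x + p" using R unfolding a_def b_def by blast+
    qed
  qed
qed

end
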